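(* Let $p$ be an odd prime, $q = p^m$, and let $\sigma = p^k$ with $m/\gcd(k,m)$ odd (so $\sigma$ denotes both the integer $p^k$ and the automorphism $x \mapsto x^{p^k}$ of $\mathbb{F}_q$). Let $a,b,c \in \mathbb{F}_q$ and define $F_1,F_2,F_3 \colon \mathbb{F}_q^3 \to \mathbb{F}_q$ by \begin{align*} F_1(x,y,z) &= x^{\sigma+1} + a y^{\sigma} z + b x^{\sigma} y + c x^{\sigma} z,\\ F_2(x,y,z) &= a y^{\sigma+1} + z^{\sigma} x + b z^{\sigma} y + c x^{\sigma} y,\\ F_3(x,y,z) &= z^{\sigma+1} - x^{\sigma} y, \end{align*} and let $F = (F_1,F_2,F_3) \colon \mathbb{F}_q^3 \to \mathbb{F}_q^3$. Then the polarization of $F$ is a semifield if and only if the equation \[ x^{\sigma^2+\sigma+1} + c x^{\sigma^2+\sigma} + b x^{\sigma^2} + a = 0 \] has no solution $x \in \mathbb{F}_q$.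
   Context: The polarization of a map $F \colon \mathbb{F}_q^n \to \mathbb{F}_q^n$ with $F(0)=0$ is $\Delta_F(u,v) = F(u+v) - F(u) - F(v)$. For the maps $F$ considered here $\Delta_F$ is symmetric and biadditive. "The polarization of $F$ is a semifield" means that $u * v := \Delta_F(u,v)$ is a (pre-)semifield multiplication on the additive group $\mathbb{F}_q^n$, i.e. $\Delta_F(u,v)=0$ implies $u=0$ or $v=0$. (No multiplicative identity is required; any such pre-semifield is isotopic to a unital one by the standard construction $(x*e)\star(e*y)=x*y$ for a fixed nonzero $e$.) *)

theory Defs
  imports "HOL-Library.Cardinality" "HOL-Library.Product_Plus"
    "HOL-Computational_Algebra.Primes"
begin

definition polarization :: "('g::ab_group_add \<Rightarrow> 'g) \<Rightarrow> 'g \<Rightarrow> 'g \<Rightarrow> 'g" where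
  "polarization F u v = F (u + v) - F u - F v"

text \<open>The additive group is required to be finite, and therefore the absence of zero divisors
  already makes left and right multiplication by a nonzero element bijective. No multiplicative
  identity is required.\<close>

definition presemifield_mult :: "('g::{ab_group_add,finite} \<Rightarrow> 'g \<Rightarrow> 'g) \<Rightarrow> bool" where
  "presemifield_mult f \<longleftrightarrow>
     (\<forall>u v w. f (u + v) w = f u w + f v w) \<and>
     (\<forall>u v w. f u (v + w) = f u v + f u w) \<and>
     (\<forall>u v. f u v = 0 \<longrightarrow> u = 0 \<or> v = 0)"

definition F1 :: "nat \<Rightarrow> 'a::field \<Rightarrow> 'a \<Rightarrow> 'a \<Rightarrow> 'a \<times> 'a \<times> 'a \<Rightarrow> 'a" where
  "F1 \<sigma> a b c = (\<lambda>(x, y, z). x ^ (\<sigma> + 1) + a * y ^ \<sigma> * z + b * x ^ \<sigma> * y + c * x ^ \<sigma> * z)"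

definition F2 :: "nat \<Rightarrow> 'a::field \<Rightarrow> 'a \<Rightarrow> 'a \<Rightarrow> 'a \<times> 'a \<times> 'a \<Rightarrow> 'a" where
  "F2 \<sigma> a b c = (\<lambda>(x, y, z). a * y ^ (\<sigma> + 1) + z ^ \<sigma> * x + b * z ^ \<sigma> * y + c * x ^ \<sigma> * y)"

definition F3 :: "nat \<Rightarrow> 'a::field \<times> 'a \<times> 'a \<Rightarrow> 'a" where
  "F3 \<sigma> = (\<lambda>(x, y, z). z ^ (\<sigma> + 1) - x ^ \<sigma> * y)"

definition F_map ::
  "nat \<Rightarrow> 'a::field \<Rightarrow> 'a \<Rightarrow> 'a \<Rightarrow> 'a \<times> 'a \<times> 'a \<Rightarrow> 'a \<times> 'a \<times> 'a" where
  "F_map \<sigma> a b c u = (F1 \<sigma> a b c u, F2 \<sigma> a b c u, F3 \<sigma> u)"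

end

theory Submission
  imports Defs "HOL-Number_Theory.Residues"
begin

text \<open>
  Let \<open>T\<close> be the semilinear map
  \<open>T (x, y, z) = (- (a y\<^sup>\<sigma> + b z\<^sup>\<sigma> + c x\<^sup>\<sigma>), z\<^sup>\<sigma>, x\<^sup>\<sigma>)\<close>. Up to an invertible linear map,
  \<open>F u\<close> is the cross product of \<open>T u\<close> and \<open>u\<close>, and the polarization is therefore
  \<open>T u \<times> v + T v \<times> u\<close>. The lines fixed by \<open>T\<close> correspond to the roots of the equation, and
  \<open>T u = \<gamma> u\<close> makes the polarization vanish at \<open>(u, u)\<close>. Conversely, let the polarization
  vanish at \<open>(u, v)\<close>. If \<open>u\<close> and \<open>v\<close> are independent, then taking the inner product with \<open>u\<close>
  and with \<open>v\<close> shows that \<open>T\<close> preserves their span, and a semilinear map of a three-dimensional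
  space that preserves a plane fixes a line. If \<open>v = \<lambda> u\<close>, then \<open>(\<lambda> + \<lambda>\<^sup>\<sigma>) (T u \<times> u) = 0\<close>,
  and \<open>\<lambda>\<^sup>\<sigma> = - \<lambda>\<close> is impossible for \<open>\<lambda> \<noteq> 0\<close> because \<open>\<sigma>\<close> has odd order as an automorphism.
\<close>

section \<open>Three-dimensional vectors\<close>

definition scale3 :: "'a::field \<Rightarrow> 'a \<times> 'a \<times> 'a \<Rightarrow> 'a \<times> 'a \<times> 'a" where
  "scale3 l = (\<lambda>(x, y, z). (l * x, l * y, l * z))"

definition dot3 :: "'a::field \<times> 'a \<times> 'a \<Rightarrow> 'a \<times> 'a \<times> 'a \<Rightarrow> 'a" where
  "dot3 = (\<lambda>(x, y, z) (x', y', z'). x * x' + y * y' + z * z')"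

definition cross3 :: "'a::field \<times> 'a \<times> 'a \<Rightarrow> 'a \<times> 'a \<times> 'a \<Rightarrow> 'a \<times> 'a \<times> 'a" where
  "cross3 = (\<lambda>(x, y, z) (x', y', z'). (y * z' - z * y', z * x' - x * z', x * y' - y * x'))"

lemmas vec3_defs = scale3_def dot3_def cross3_def

lemma dot3_add: "dot3 (u + v) w = dot3 u w + dot3 v w"
  by (auto simp: vec3_defs algebra_simps prod_eq_iff case_prod_beta)

lemma dot3_diff: "dot3 (u - v) w = dot3 u w - dot3 v w"
  by (auto simp: vec3_defs algebra_simps prod_eq_iff case_prod_beta)

lemma dot3_uminus: "dot3 (- u) w = - dot3 u w"
  by (auto simp: vec3_defs algebra_simps prod_eq_iff case_prod_beta)

lemma dot3_scale3: "dot3 (scale3 l u) w = l * dot3 u w"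
  by (auto simp: vec3_defs algebra_simps prod_eq_iff case_prod_beta)

lemma dot3_zero: "dot3 0 w = 0"
  by (auto simp: vec3_defs zero_prod_def split: prod.splits)

lemma scale3_diff: "scale3 l (u - v) = scale3 l u - scale3 l v"
  by (auto simp: vec3_defs algebra_simps prod_eq_iff case_prod_beta)

lemma scale3_add: "scale3 l (u + v) = scale3 l u + scale3 l v"
  by (auto simp: vec3_defs algebra_simps prod_eq_iff case_prod_beta)

lemma scale3_scale3: "scale3 l (scale3 l' u) = scale3 (l * l') u"
  by (simp add: scale3_def case_prod_beta mult.assoc)

lemma scale3_one [simp]: "scale3 1 u = u"
  by (simp add: scale3_def)

lemma scale3_zero_left [simp]: "scale3 0 u = 0"
  by (simp add: scale3_def zero_prod_def case_prod_beta)

lemma dot3_nondegenerate: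
  assumes "d \<noteq> 0"
  obtains w where "dot3 w d \<noteq> 0"
proof -
  obtain x y z where d: "d = (x, y, z)"
    by (cases d) auto
  have "dot3 (1, 0, 0) d = x" "dot3 (0, 1, 0) d = y" "dot3 (0, 0, 1) d = z"
    by (simp_all add: d dot3_def)
  then show thesis
    using assms that by (metis d zero_prod_def)
qed

text \<open>The inner product of the hypothesis with \<open>u\<close> kills
  \<open>cross3 v' u\<close> and leaves a triple product of \<open>u'\<close>, \<open>v\<close> and
  \<open>u\<close>; the inner product with \<open>v\<close> does the same for
  \<open>v'\<close>.\<close>

lemma dot3_cross3_of_sum_zero:
  assumes "cross3 u' v + cross3 v' u = 0"
  shows "dot3 u' (cross3 u v) = 0" "dot3 v' (cross3 u v) = 0"
proof -
  have "dot3 u' (cross3 u v) = - dot3 (cross3 u' v + cross3 v' u) u"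
    by (auto simp: vec3_defs algebra_simps prod_eq_iff case_prod_beta)
  then show "dot3 u' (cross3 u v) = 0"
    by (simp add: assms dot3_zero)
  have "dot3 v' (cross3 u v) = dot3 (cross3 u' v + cross3 v' u) v"
    by (auto simp: vec3_defs algebra_simps prod_eq_iff case_prod_beta)
  then show "dot3 v' (cross3 u v) = 0"
    by (simp add: assms dot3_zero)
qed

text \<open>Cramer's rule without division, with triple products as coefficients. If
  \<open>w\<close> is orthogonal to \<open>cross3 u v\<close>, the term in \<open>e\<close> drops
  out.\<close>

lemma cramer3:
  "scale3 (dot3 e (cross3 u v)) w = scale3 (dot3 e (cross3 w v)) u +
    scale3 (dot3 e (cross3 u w)) v + scale3 (dot3 w (cross3 u v)) e"
  by (cases u, cases v, cases w, cases e) (simp add: vec3_defs algebra_simps)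

lemma orthogonal_cross3_imp_span:
  assumes "cross3 u v \<noteq> 0" and "dot3 w (cross3 u v) = 0"
  obtains s t where "w = scale3 s u + scale3 t v"
proof -
  \<comment> \<open>Since \<open>e\<close> lies outside the plane of \<open>u\<close> and
    \<open>v\<close>, the coefficient of \<open>w\<close> in Cramer's rule is invertible.\<close>
  obtain e where e: "dot3 e (cross3 u v) \<noteq> 0"
    using dot3_nondegenerate[OF assms(1)] .
  let ?i = "scale3 (inverse (dot3 e (cross3 u v)))"
  have "w = ?i (scale3 (dot3 e (cross3 u v)) w)"
    using e by (simp add: scale3_scale3)
  also have "\<dots> = ?i (scale3 (dot3 e (cross3 w v)) u + scale3 (dot3 e (cross3 u w)) v)"
    by (simp add: cramer3[of e u v w] assms(2))
  finally show thesis
    using that by (simp add: scale3_add scale3_scale3)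
qed

lemma cross3_eq_zero_imp_scale3:
  assumes "cross3 u v = 0" "u \<noteq> 0"
  obtains l where "v = scale3 l u"
proof -
  obtain x y z x' y' z' where uv: "u = (x, y, z)" "v = (x', y', z')"
    by (cases u, cases v) auto
  have c: "y * z' = z * y'" "z * x' = x * z'" "x * y' = y * x'"
    using assms(1) by (auto simp: uv cross3_def zero_prod_def)
  consider "x \<noteq> 0" | "y \<noteq> 0" | "z \<noteq> 0"
    using assms(2) by (auto simp: uv zero_prod_def)
  then show thesis
  proof cases
    case 1
    then show thesis using c by (intro that[of "x' / x"]) (auto simp: uv scale3_def field_simps)
  next
    case 2
    then show thesis using c by (intro that[of "y' / y"]) (auto simp: uv scale3_def field_simps)
  next
    case 3
    then show thesis using c by (intro that[of "z' / z"]) (auto simp: uv scale3_def field_simps)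
  qed
qed

section \<open>Semilinear maps with an invariant plane\<close>

text \<open>
  Let \<open>\<gamma>\<close> be the eigenvalue of \<open>T\<close> on the quotient by the plane. If \<open>T - \<gamma>\<close> is injective on the
  plane, then it is bijective there by finiteness, and \<open>w\<close> can be corrected by an element of the
  plane.
\<close>
lemma semilinear_invariant_plane_imp_fixed_line:
  fixes T :: "'a::{field,finite} \<times> 'a \<times> 'a \<Rightarrow> 'a \<times> 'a \<times> 'a"
  assumes add: "\<And>u v. T (u + v) = T u + T v"
    and inv: "\<And>w. dot3 w d = 0 \<Longrightarrow> dot3 (T w) d = 0"
    and "d \<noteq> 0"
  obtains u \<gamma> where "u \<noteq> 0" "T u = scale3 \<gamma> u"
proof -
  obtain w where w: "dot3 w d \<noteq> 0"
    using dot3_nondegenerate[OF \<open>d \<noteq> 0\<close>] .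
  define \<gamma> where "\<gamma> = dot3 (T w) d / dot3 w d"
  define W where "W = {w. dot3 w d = 0}"
  define g where "g = (\<lambda>u. T u - scale3 \<gamma> u)"
  have T_diff: "T (u - v) = T u - T v" for u v
    using add[of "u - v" v] by simp
  have gw: "dot3 (g w) d = 0"
    using w by (simp add: g_def dot3_diff dot3_scale3 \<gamma>_def)
  have g_W: "g ` W \<subseteq> W"
    by (auto simp: W_def g_def dot3_diff dot3_scale3 inv)
  show thesis
  proof (cases "inj_on g W")
    case True
    then have "g ` W = W"
      using g_W endo_inj_surj[of W g] by simp
    moreover have "- g w \<in> W"
      by (simp add: W_def dot3_uminus gw)
    ultimately obtain s where s: "s \<in> W" "g s = - g w"
      by (metis imageE)
    have "T (w + s) = scale3 \<gamma> (w + s)"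
      using s(2) by (simp add: g_def add scale3_add algebra_simps)
    moreover have "w + s \<noteq> 0"
      using w s(1) dot3_add[of w s d] by (auto simp: W_def dot3_zero)
    ultimately show thesis
      using that by blast
  next
    case False
    \<comment> \<open>As \<open>g\<close> is additive, it kills the difference of two elements with
      the same image.\<close>
    then obtain u v where "u \<noteq> v" "g u = g v"
      unfolding inj_on_def by blast
    then have "u - v \<noteq> 0" "T (u - v) = scale3 \<gamma> (u - v)"
      by (simp_all add: g_def T_diff scale3_diff algebra_simps)
    then show thesis
      using that by blast
  qed
qed

section \<open>Frobenius automorphisms of finite fields\<close>

text \<open>Multiplication by a nonzero \<open>x\<close> permutes the nonzero elements, yet
  multiplies their product by \<open>x ^ (CARD('a) - 1)\<close>.\<close>

lemma finite_field_power_CARD: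
  fixes x :: "'a::{field,finite}"
  shows "x ^ CARD('a) = x"
proof (cases "x = 0")
  case False
  let ?P = "\<Prod>y\<in>UNIV - {0 :: 'a}. y"
  have "bij_betw ((*) x) (UNIV - {0}) (UNIV - {0})"
    by (rule bij_betwI[where g = "\<lambda>y. y / x"]) (use False in auto)
  then have "?P = (\<Prod>y\<in>UNIV - {0}. x * y)"
    by (rule prod.reindex_bij_betw[symmetric])
  also have "\<dots> = x ^ (CARD('a) - 1) * ?P"
    by (simp add: prod.distrib)
  finally have "x ^ (CARD('a) - 1) = 1"
    by simp
  then show ?thesis
    using power_minus_mult[of "CARD('a)" x] by simp
qed simp

lemma finite_field_power_CARD_power:
  fixes x :: "'a::{field,finite}"
  shows "x ^ (CARD('a) ^ n) = x"
  by (induction n) (simp_all add: finite_field_power_CARD power_mult)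

lemma CHAR_eq_of_CARD_eq_prime_power:
  assumes "prime p" "CARD('a::{field,finite}) = p ^ m"
  shows "CHAR('a) = p"
proof -
  have "prime CHAR('a)"
    using prime_CHAR_semidom[where ?'a = 'a] finite_imp_CHAR_pos[where ?'a = 'a] by simp
  moreover have "CHAR('a) dvd p ^ m"
    using CHAR_dvd_CARD[where ?'a = 'a] by (simp add: assms(2))
  ultimately show ?thesis
    using assms(1) by (metis prime_dvd_power primes_dvd_imp_eq)
qed

text \<open>Otherwise each application of the automorphism flips the sign of \<open>l\<close>. Its
  iterate of odd order \<open>m div gcd k m\<close> is the identity, so
  \<open>2 * l = 0\<close>.\<close>

lemma odd_order_frobenius_neq_uminus:
  fixes l :: "'a::{field,finite}"
  assumes "prime p" "odd p" "CARD('a) = p ^ m" "odd (m div gcd k m)" "l \<noteq> 0"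
  shows "l ^ (p ^ k) \<noteq> - l"
proof
  assume l: "l ^ (p ^ k) = - l"
  have iter: "l ^ ((p ^ k) ^ n) = (- 1) ^ n * l" for n
  proof (induction n)
    case (Suc n)
    have "l ^ ((p ^ k) ^ Suc n) = (l ^ ((p ^ k) ^ n)) ^ (p ^ k)"
      by (simp add: power_mult[symmetric] mult.commute)
    also have "\<dots> = ((- 1) ^ (p ^ k)) ^ n * l ^ (p ^ k)"
      unfolding Suc power_mult_distrib by (simp only: mult.commute flip: power_mult)
    also have "(- 1 :: 'a) ^ (p ^ k) = - 1"
      using assms(2) by simp
    finally show ?case
      by (simp add: l)
  qed simp
  have "k * (m div gcd k m) = m * (k div gcd k m)"
    by (metis div_mult_swap dvd_div_mult gcd_dvd1 gcd_dvd2 mult.commute)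
  then have "(p ^ k) ^ (m div gcd k m) = CARD('a) ^ (k div gcd k m)"
    by (simp add: assms(3) power_mult[symmetric])
  then have "l = (- 1) ^ (m div gcd k m) * l"
    using iter[of "m div gcd k m"] by (simp add: finite_field_power_CARD_power)
  then have "2 * l = 0"
    using assms(4) by simp
  then have "of_nat 2 = (0 :: 'a)"
    using assms(5) by simp
  then have "p dvd 2"
    using CHAR_eq_of_CARD_eq_prime_power[OF assms(1,3)] by (simp only: of_nat_eq_0_iff_char_dvd)
  then show False
    using assms(1,2) by (metis primes_dvd_imp_eq two_is_prime_nat even_numeral)
qed

section \<open>The polarization as a cross product\<close>

definition twist :: "nat \<Rightarrow> 'a::field \<Rightarrow> 'a \<Rightarrow> 'a \<Rightarrow> 'a \<times> 'a \<times> 'a \<Rightarrow> 'a \<times> 'a \<times> 'a" where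
  "twist \<sigma> a b c = (\<lambda>(x, y, z). (- (a * y ^ \<sigma> + b * z ^ \<sigma> + c * x ^ \<sigma>), z ^ \<sigma>, x ^ \<sigma>))"

definition twisted_sum :: "nat \<Rightarrow> 'a::field \<Rightarrow> 'a \<Rightarrow> 'a \<Rightarrow>
    'a \<times> 'a \<times> 'a \<Rightarrow> 'a \<times> 'a \<times> 'a \<Rightarrow> 'a \<times> 'a \<times> 'a" where
  "twisted_sum \<sigma> a b c u v = cross3 (twist \<sigma> a b c u) v + cross3 (twist \<sigma> a b c v) u"

text \<open>At \<open>u\<close>, the components of \<open>cross3 (twist \<sigma> a b c u) u\<close>
  are \<open>F3\<close>, \<open>F1 + b * F3\<close> and \<open>- F2\<close>; this map turns them
  into \<open>F_map\<close>.\<close>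

definition recombine :: "'a::field \<Rightarrow> 'a \<times> 'a \<times> 'a \<Rightarrow> 'a \<times> 'a \<times> 'a" where
  "recombine b = (\<lambda>(x, y, z). (y - b * x, - z, x))"

lemma recombine_add: "recombine b (u + v) = recombine b u + recombine b v"
  by (auto simp: recombine_def algebra_simps prod_eq_iff case_prod_beta)

lemma recombine_eq_zero_iff: "recombine b u = 0 \<longleftrightarrow> u = 0"
  by (auto simp: recombine_def zero_prod_def split: prod.splits)

lemma twist_scale3: "twist \<sigma> a b c (scale3 l u) = scale3 (l ^ \<sigma>) (twist \<sigma> a b c u)"
  by (auto simp: twist_def scale3_def algebra_simps prod_eq_iff case_prod_beta)

lemma twisted_sum_scale3:
  "twisted_sum \<sigma> a b c u (scale3 l u) = scale3 (l + l ^ \<sigma>) (cross3 (twist \<sigma> a b c u) u)"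
  unfolding twisted_sum_def twist_scale3
  by (auto simp: vec3_defs algebra_simps prod_eq_iff case_prod_beta)

lemma twist_add:
  fixes u v :: "'a::field \<times> 'a \<times> 'a"
  assumes frob: "\<And>x y :: 'a. (x + y) ^ \<sigma> = x ^ \<sigma> + y ^ \<sigma>"
  shows "twist \<sigma> a b c (u + v) = twist \<sigma> a b c u + twist \<sigma> a b c v"
  by (auto simp: twist_def frob algebra_simps prod_eq_iff case_prod_beta)

lemma twisted_sum_add:
  fixes u v w :: "'a::field \<times> 'a \<times> 'a"
  assumes frob: "\<And>x y :: 'a. (x + y) ^ \<sigma> = x ^ \<sigma> + y ^ \<sigma>"
  shows "twisted_sum \<sigma> a b c (u + v) w = twisted_sum \<sigma> a b c u w + twisted_sum \<sigma> a b c v w"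
    and "twisted_sum \<sigma> a b c u (v + w) = twisted_sum \<sigma> a b c u v + twisted_sum \<sigma> a b c u w"
  unfolding twisted_sum_def twist_add[OF frob]
  by (auto simp: cross3_def algebra_simps prod_eq_iff case_prod_beta)

text \<open>\<open>F_map\<close> at \<open>u\<close> is a linear image of
  \<open>cross3 (twist \<sigma> a b c u) u\<close>. Both \<open>twist\<close> and
  \<open>cross3\<close> are additive, so polarizing leaves the two mixed terms.\<close>

lemma polarization_F_map:
  fixes u v :: "'a::field \<times> 'a \<times> 'a"
  assumes frob: "\<And>x y :: 'a. (x + y) ^ \<sigma> = x ^ \<sigma> + y ^ \<sigma>"
  shows "polarization (F_map \<sigma> a b c) u v = recombine b (twisted_sum \<sigma> a b c u v)"
  by (auto simp: polarization_def F_map_def F1_def F2_def F3_def recombine_def twisted_sum_def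
      twist_def cross3_def frob algebra_simps prod_eq_iff case_prod_beta)

section \<open>Fixed lines and roots\<close>

text \<open>A root \<open>x\<close> corresponds to the line through \<open>(x\<^sup>\<sigma>\<^sup>+\<^sup>1, 1, x\<^sup>\<sigma>)\<close>.\<close>
lemma twist_fixed_line_iff_root:
  fixes a b c :: "'a::field"
  assumes "\<sigma> > 0"
  shows "(\<exists>u l. u \<noteq> 0 \<and> twist \<sigma> a b c u = scale3 l u) \<longleftrightarrow>
    (\<exists>x. x ^ (\<sigma>\<^sup>2 + \<sigma> + 1) + c * x ^ (\<sigma>\<^sup>2 + \<sigma>) + b * x ^ (\<sigma>\<^sup>2) + a = 0)"
proof
  assume "\<exists>x. x ^ (\<sigma>\<^sup>2 + \<sigma> + 1) + c * x ^ (\<sigma>\<^sup>2 + \<sigma>) + b * x ^ (\<sigma>\<^sup>2) + a = 0"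
  then obtain x where x: "x ^ (\<sigma>\<^sup>2 + \<sigma> + 1) + c * x ^ (\<sigma>\<^sup>2 + \<sigma>) + b * x ^ (\<sigma>\<^sup>2) + a = 0" ..
  have pow: "(x ^ \<sigma>) ^ \<sigma> = x ^ \<sigma>\<^sup>2" "(x ^ (\<sigma> + 1)) ^ \<sigma> = x ^ (\<sigma>\<^sup>2 + \<sigma>)"
    by (simp_all add: algebra_simps power2_eq_square power_add flip: power_mult)
  have "- (a + b * x ^ \<sigma>\<^sup>2 + c * x ^ (\<sigma>\<^sup>2 + \<sigma>)) = x ^ (\<sigma>\<^sup>2 + \<sigma> + 1)"
    using x by (simp add: neg_eq_iff_add_eq_0 algebra_simps)
  \<comment> \<open>The second coordinate \<open>1\<close> forces the eigenvalue; the root equation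
    supplies the first coordinate.\<close>
  then have "twist \<sigma> a b c (x ^ (\<sigma> + 1), 1, x ^ \<sigma>) = scale3 (x ^ \<sigma>\<^sup>2) (x ^ (\<sigma> + 1), 1, x ^ \<sigma>)"
    unfolding twist_def scale3_def by (simp only: split pow) (simp add: power_add mult.assoc)
  then show "\<exists>u l. u \<noteq> 0 \<and> twist \<sigma> a b c u = scale3 l u"
    by (intro exI[of _ "(x ^ (\<sigma> + 1), 1, x ^ \<sigma>)"] exI) (auto simp: zero_prod_def)
next
  assume "\<exists>u l. u \<noteq> 0 \<and> twist \<sigma> a b c u = scale3 l u"
  then obtain x y z l where nz: "(x, y, z) \<noteq> 0" and
    fixed: "twist \<sigma> a b c (x, y, z) = scale3 l (x, y, z)"
    by (metis prod_cases3)
  have eqs: "- (a * y ^ \<sigma> + b * z ^ \<sigma> + c * x ^ \<sigma>) = l * x" "z ^ \<sigma> = l * y" "x ^ \<sigma> = l * z"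
    using fixed unfolding twist_def scale3_def prod.case prod.inject by blast+
  show "\<exists>x. x ^ (\<sigma>\<^sup>2 + \<sigma> + 1) + c * x ^ (\<sigma>\<^sup>2 + \<sigma>) + b * x ^ (\<sigma>\<^sup>2) + a = 0"
  proof (cases "l = 0")
    case True
    \<comment> \<open>Only \<open>y\<close> can be nonzero here, which forces \<open>a = 0\<close>
      and makes \<open>0\<close> a root.\<close>
    then have "x = 0" "z = 0"
      using eqs by auto
    then have "a = 0"
      using nz eqs(1) True assms by (auto simp: zero_prod_def power_0_left)
    then show ?thesis
      using assms by (intro exI[of _ 0]) (auto simp: power_0_left)
  next
    case False
    have y: "y \<noteq> 0"
      using nz eqs False assms by (auto simp: zero_prod_def)
    then have z: "z \<noteq> 0"
      using eqs False assms by (metis no_zero_divisors power_0_left not_gr0)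
    \<comment> \<open>On the line through \<open>(x ^ (\<sigma> + 1), 1, x ^ \<sigma>)\<close> with
      \<open>x\<close> nonzero, this ratio of the first to the third coordinate is the root
      \<open>x\<close>.\<close>
    define t where "t = x / z"
    have t1: "t ^ \<sigma> = z / y"
      using False y z by (simp add: t_def power_divide eqs)
    have t2: "t ^ \<sigma>\<^sup>2 = z ^ \<sigma> / y ^ \<sigma>"
      unfolding power2_eq_square power_mult t1 by (simp add: power_divide)
    have t3: "t ^ (\<sigma>\<^sup>2 + \<sigma>) = x ^ \<sigma> / y ^ \<sigma>"
      using y by (simp add: power_add t1 t2 eqs)
    have t4: "t ^ (\<sigma>\<^sup>2 + \<sigma> + 1) = l * x / y ^ \<sigma>"
      using z by (simp only: power_add[of t "\<sigma>\<^sup>2 + \<sigma>"] t3 eqs(3)) (simp add: t_def)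
    have "(t ^ (\<sigma>\<^sup>2 + \<sigma> + 1) + c * t ^ (\<sigma>\<^sup>2 + \<sigma>) + b * t ^ \<sigma>\<^sup>2 + a) * y ^ \<sigma> =
        l * x + (a * y ^ \<sigma> + b * z ^ \<sigma> + c * x ^ \<sigma>)"
      unfolding t2 t3 t4 using y by (simp add: distrib_right)
    also have "\<dots> = 0"
      by (simp flip: eqs(1))
    finally show ?thesis
      using y by auto
  qed
qed

theorem theorem1p6:
  fixes p m k \<sigma> :: nat
    and a b c :: "'a::{field,finite}"
  assumes "prime p" and "odd p"
    and "CARD('a) = p ^ m"
    and "\<sigma> = p ^ k"
    and "odd (m div gcd k m)"
  shows "presemifield_mult (polarization (F_map \<sigma> a b c)) \<longleftrightarrow>
    \<not> (\<exists>x::'a. x ^ (\<sigma>\<^sup>2 + \<sigma> + 1) + c * x ^ (\<sigma>\<^sup>2 + \<sigma>) + b * x ^ (\<sigma>\<^sup>2) + a = 0)"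
proof -
  have pos: "\<sigma> > 0"
    using assms(1,4) by (simp add: prime_gt_0_nat)
  have frob: "(x + y) ^ \<sigma> = x ^ \<sigma> + y ^ \<sigma>" for x y :: 'a
    using freshmans_dream'[of \<sigma> k x y] assms(1,4)
      CHAR_eq_of_CARD_eq_prime_power[OF assms(1,3)] by simp
  let ?T = "twist \<sigma> a b c" and ?D = "twisted_sum \<sigma> a b c"
  have "presemifield_mult (polarization (F_map \<sigma> a b c)) \<longleftrightarrow>
      (\<forall>u v. ?D u v = 0 \<longrightarrow> u = 0 \<or> v = 0)"
    by (simp add: presemifield_mult_def polarization_F_map[OF frob] twisted_sum_add[OF frob]
        recombine_add recombine_eq_zero_iff)
  also have "\<dots> \<longleftrightarrow> \<not> (\<exists>u l. u \<noteq> 0 \<and> ?T u = scale3 l u)"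
  proof
    assume *: "\<forall>u v. ?D u v = 0 \<longrightarrow> u = 0 \<or> v = 0"
    have "?D u u = 0" if "?T u = scale3 l u" for u l
      by (auto simp: twisted_sum_def that vec3_defs zero_prod_def split: prod.splits)
    with * show "\<not> (\<exists>u l. u \<noteq> 0 \<and> ?T u = scale3 l u)"
      by blast
  next
    assume no_fixed: "\<not> (\<exists>u l. u \<noteq> 0 \<and> ?T u = scale3 l u)"
    show "\<forall>u v. ?D u v = 0 \<longrightarrow> u = 0 \<or> v = 0"
    proof (intro allI impI, rule ccontr)
      fix u v assume D: "?D u v = 0" and "\<not> (u = 0 \<or> v = 0)"
      then have nz: "u \<noteq> 0" "v \<noteq> 0"
        by auto
      show False
      proof (cases "cross3 u v = 0")
        case True
        then obtain l where v: "v = scale3 l u"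
          using nz(1) by (rule cross3_eq_zero_imp_scale3)
        have "l \<noteq> 0"
          using nz(2) by (auto simp: v scale3_def zero_prod_def split: prod.splits)
        then have "l + l ^ \<sigma> \<noteq> 0"
          using odd_order_frobenius_neq_uminus[OF assms(1-3,5), of l] assms(4)
          by (simp add: add_eq_0_iff)
        then have "cross3 (?T u) u = 0"
          using D unfolding v twisted_sum_scale3
          by (auto simp: scale3_def zero_prod_def split: prod.splits)
        then have "cross3 u (?T u) = 0"
          by (auto simp: cross3_def zero_prod_def algebra_simps split: prod.splits)
        then show False
          using cross3_eq_zero_imp_scale3[OF _ nz(1)] no_fixed nz(1) by metis
      next
        case False
        let ?d = "cross3 u v"
        have orth: "dot3 (?T u) ?d = 0" "dot3 (?T v) ?d = 0"
          using dot3_cross3_of_sum_zero D unfolding twisted_sum_def by blast+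
        \<comment> \<open>The plane orthogonal to \<open>?d\<close> is spanned by \<open>u\<close>
          and \<open>v\<close>, so by semilinearity their two images decide its invariance.\<close>
        have "dot3 (?T w) ?d = 0" if "dot3 w ?d = 0" for w
        proof -
          obtain s t where "w = scale3 s u + scale3 t v"
            using False \<open>dot3 w ?d = 0\<close> by (rule orthogonal_cross3_imp_span)
          then show ?thesis
            by (simp add: twist_add[OF frob] twist_scale3 dot3_add dot3_scale3 orth)
        qed
        then show False
          using semilinear_invariant_plane_imp_fixed_line[of ?T, OF twist_add[OF frob] _ False] no_fixed
          by metis
      qed
    qed
  qed
  also have "\<dots> \<longleftrightarrow>
      \<not> (\<exists>x. x ^ (\<sigma>\<^sup>2 + \<sigma> + 1) + c * x ^ (\<sigma>\<^sup>2 + \<sigma>) + b * x ^ (\<sigma>\<^sup>2) + a = 0)"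
    by (simp only: twist_fixed_line_iff_root[OF pos])
  finally show ?thesis .
qed

end
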